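(* Let $A_1,\dots,A_m\in\mathbb{S}^n$ be such that $I_n,A_1,\dots,A_m$ are linearly independent, let $\mathbf{b}\in\mathbb{R}^m$, let $f(\mathbf{y})=\log\operatorname{tr}\exp A(\mathbf{y})-\mathbf{b}^T\mathbf{y}$, and let $G_0$ be the centered Gram matrix of $A_1,\dots,A_m$. Then for every $\mathbf{y}\in\mathbb{R}^m$, with $X(\mathbf{y})=\exp A(\mathbf{y})/\operatorname{tr}\exp A(\mathbf{y})\succ0$, $$\nabla^2 f(\mathbf{y})\succeq\lambda_{\min}(X(\mathbf{y}))\,G_0 .$$
   Context: $\mathbb{S}^n$ is the space of real symmetric $n\times n$ matrices. $A(\mathbf{y})=\sum_{i=1}^m y_iA_i$. The centered Gram matrix is $G_0=[\operatorname{tr}(A_i^0A_j^0)]_{i,j=1}^m$, where $A_i^0=A_i-\tfrac{\operatorname{tr}A_i}{n}I_n$. $\lambda_{\min}$ denotes the smallest eigenvalue. *)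

theory Defs
  imports "HOL-Analysis.Analysis"
begin

(* The product and power of the type class instance for vec are entrywise, so the exponential
   series is written with the matrix product.  It converges in the norm of real^'n^'n. *)
definition matrix_exp :: "real^'n^'n \<Rightarrow> real^'n^'n" where
  "matrix_exp M = (\<Sum>k. (1 / fact k) *\<^sub>R (((\<lambda>P. M ** P) ^^ k) (mat 1)))"

definition symmetric_matrix :: "real^'n^'n \<Rightarrow> bool" where
  "symmetric_matrix M \<longleftrightarrow> transpose M = M"

definition pos_semidef :: "real^'n^'n \<Rightarrow> bool" where
  "pos_semidef M \<longleftrightarrow> symmetric_matrix M \<and> (\<forall>x. 0 \<le> x \<bullet> (M *v x))"

definition pos_def :: "real^'n^'n \<Rightarrow> bool" where
  "pos_def M \<longleftrightarrow> symmetric_matrix M \<and> (\<forall>x. x \<noteq> 0 \<longrightarrow> 0 < x \<bullet> (M *v x))"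

definition loewner_le :: "real^'n^'n \<Rightarrow> real^'n^'n \<Rightarrow> bool"  (infix \<open>\<preceq>\<^sub>L\<close> 50) where
  "P \<preceq>\<^sub>L Q \<longleftrightarrow> pos_semidef (Q - P)"

definition eigenvalues :: "real^'n^'n \<Rightarrow> real set" where
  "eigenvalues M = {c. \<exists>v. v \<noteq> 0 \<and> M *v v = c *\<^sub>R v}"

(* Min is meaningful only on a nonempty set: intended for symmetric M, whose eigenvalues
   are all real. *)
definition lambda_min :: "real^'n^'n \<Rightarrow> real" where
  "lambda_min M = Min (eigenvalues M)"

(* H is the (Frechet) derivative at y of a gradient field of f defined near y. *)
definition has_hessian :: "(real^'m \<Rightarrow> real) \<Rightarrow> real^'m^'m \<Rightarrow> real^'m \<Rightarrow> bool" where
  "has_hessian f H y \<longleftrightarrow>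
     (\<exists>g. (\<forall>\<^sub>F z in nhds y. GDERIV f z :> g z) \<and> (g has_derivative (\<lambda>h. H *v h)) (at y))"

definition hessian :: "(real^'m \<Rightarrow> real) \<Rightarrow> real^'m \<Rightarrow> real^'m^'m" where
  "hessian f y = (THE H. has_hessian f H y)"

lemma has_hessian_unique:
  assumes "has_hessian f H y" and "has_hessian f K y"
  shows "H = K"
proof -
  obtain g where g: "\<forall>\<^sub>F z in nhds y. GDERIV f z :> g z" "(g has_derivative (\<lambda>h. H *v h)) (at y)"
    using assms(1) unfolding has_hessian_def by blast
  obtain k where k: "\<forall>\<^sub>F z in nhds y. GDERIV f z :> k z" "(k has_derivative (\<lambda>h. K *v h)) (at y)"
    using assms(2) unfolding has_hessian_def by blast
  have eq: "u = v" if "GDERIV f z :> u" "GDERIV f z :> v" for z u v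
  proof -
    have "(\<lambda>h. h \<bullet> u) = (\<lambda>h. h \<bullet> v)"
      using that unfolding gderiv_def by (rule has_derivative_unique)
    then show ?thesis by (metis vector_eq_ldot)
  qed
  have ev: "\<forall>\<^sub>F z in nhds y. g z = k z"
    using g(1) k(1) by eventually_elim (rule eq)
  have "(k has_derivative (\<lambda>h. H *v h)) (at y)"
    using g(2) _ eventually_nhds_x_imp_x[OF ev]
    by (rule has_derivative_transform_eventually)
       (use ev in \<open>auto simp: eventually_at_filter elim: eventually_mono\<close>)
  then have "(\<lambda>h. H *v h) = (\<lambda>h. K *v h)"
    using k(2) by (rule has_derivative_unique)
  then show ?thesis by (metis matrix_eq)
qed

lemma hessian_eq: "has_hessian f H y \<Longrightarrow> hessian f y = H"
  unfolding hessian_def using has_hessian_unique by blast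

definition lin_comb :: "('m::finite \<Rightarrow> real^'n^'n) \<Rightarrow> real^'m \<Rightarrow> real^'n^'n" where
  "lin_comb A y = (\<Sum>i\<in>UNIV. y $ i *\<^sub>R A i)"

definition centered :: "real^'n^'n \<Rightarrow> real^'n^'n" where
  "centered M = M - (trace M / real CARD('n)) *\<^sub>R mat 1"

definition centered_gram :: "('m::finite \<Rightarrow> real^'n^'n) \<Rightarrow> real^'m^'m" where
  "centered_gram A = (\<chi> i j. trace (centered (A i) ** centered (A j)))"

definition log_trace_exp :: "('m::finite \<Rightarrow> real^'n^'n) \<Rightarrow> real^'m \<Rightarrow> real^'m \<Rightarrow> real" where
  "log_trace_exp A b y = ln (trace (matrix_exp (lin_comb A y))) - b \<bullet> y"

definition gibbs_matrix :: "('m::finite \<Rightarrow> real^'n^'n) \<Rightarrow> real^'m \<Rightarrow> real^'n^'n" where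
  "gibbs_matrix A y =
     (1 / trace (matrix_exp (lin_comb A y))) *\<^sub>R matrix_exp (lin_comb A y)"

end

theory Submission
  imports Defs
begin

text \<open>
  Write $M = A(y)$, $E = \exp M$, $Z = \mathrm{tr}\, E$, $X = E/Z$, and let $D$ be the derivative
  of the matrix exponential at $M$.  In a direction $h$, with $B = A(h)$, the Hessian form of $f$ is
  $\mathrm{tr}(D(B)\,B)/Z - (\mathrm{tr}(E B)/Z)^2$ (lemma \<open>inner_log_trace_exp_hess\<close>).
  Subtracting a variance is the same as recentring: since $D(I) = E$ and
  $\mathrm{tr}\, D(B) = \mathrm{tr}(E B)$, the form equals $\mathrm{tr}(D(H)\,H)/Z$ for
  $H = B - cI$ with $c = \mathrm{tr}(E B)/Z$ (lemma \<open>trace_matrix_exp_deriv_shift\<close>).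

  Everything therefore rests on the bound $\mathrm{tr}(D(H)\,H) \ge \mu\,\mathrm{tr}(H^2)$ for
  symmetric $H$, with $\mu$ an eigenvalue of $E$ (lemma
  \<open>symmetric_matrix_exp_min_eigenvalue\<close>).  It comes from a shift that makes the
  exponential series termwise nonnegative.  Let $m$ be the least eigenvalue of $M$, obtained by
  minimising the Rayleigh quotient, so that $N = M - mI$ is positive semidefinite and singular.
  Because $\exp M = e^m \exp N$, the derivative of $\exp$ at $M$ is $e^m$ times the one at $N$, and
  \[ \mathrm{tr}(D_N(H)\,H) = \sum_{k \ge 1} \frac{1}{k!} \sum_{j<k}
     \mathrm{tr}\bigl(N^j \, H N^{k-1-j} H\bigr). \]
  Each summand is the trace of a product of two positive semidefinite matrices, hence nonnegative
  (lemma \<open>trace_mult_pos_semidef_nonneg\<close>), and the term $k = 1$ is $\mathrm{tr}(H^2)$.  So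
  $\mu = e^m$ works; it is an eigenvalue of $E$ since $N$ has a null vector.

  Finally $\lambda_{\min}(X) \le \mu/Z$, and $\mathrm{tr}(H^2)$ is at least the trace of the square
  of the centred matrix $B - (\mathrm{tr}\,B/n)I$, because that choice of shift minimises
  $\mathrm{tr}((B - cI)^2)$ over $c$; the latter trace is the quadratic form of $G_0$ at $h$.
\<close>

section \<open>Linearity of the matrix operations\<close>

interpretation matmul: bounded_bilinear "(**) :: real^'n^'n \<Rightarrow> real^'n^'n \<Rightarrow> real^'n^'n"
proof -
  have "bilinear ((**) :: real^'n^'n \<Rightarrow> real^'n^'n \<Rightarrow> real^'n^'n)"
    unfolding bilinear_def
    by (auto intro!: linearI simp: matrix_add_ldistrib vec_eq_iff
        matrix_matrix_mult_def sum_distrib_left sum.distrib algebra_simps)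
  then show "bounded_bilinear ((**) :: real^'n^'n \<Rightarrow> real^'n^'n \<Rightarrow> real^'n^'n)"
    by (simp add: bilinear_conv_bounded_bilinear)
qed

interpretation matvec: bounded_bilinear "(*v) :: real^'n^'n \<Rightarrow> real^'n \<Rightarrow> real^'n"
proof -
  have "bilinear ((*v) :: real^'n^'n \<Rightarrow> real^'n \<Rightarrow> real^'n)"
    unfolding bilinear_def
    by (auto intro!: linearI simp: vec_eq_iff matrix_vector_mult_def sum_distrib_left
        sum.distrib algebra_simps)
  then show "bounded_bilinear ((*v) :: real^'n^'n \<Rightarrow> real^'n \<Rightarrow> real^'n)"
    by (simp add: bilinear_conv_bounded_bilinear)
qed

lemma bounded_linear_trace: "bounded_linear (trace :: real^'n^'n \<Rightarrow> real)"
  by (intro linear_conv_bounded_linear[THEN iffD1] linearI)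
     (auto simp: trace_def sum.distrib sum_distrib_left)

lemma bounded_linear_transpose: "bounded_linear (transpose :: real^'n^'n \<Rightarrow> real^'n^'n)"
  by (intro linear_conv_bounded_linear[THEN iffD1] linearI)
     (auto simp: transpose_def vec_eq_iff)

lemmas trace_linear = linear_simps[OF bounded_linear_trace]
lemmas transpose_linear = linear_simps[OF bounded_linear_transpose]

section \<open>Positive semidefinite matrices\<close>

lemma symmetric_dot_commute:
  fixes M :: "real^'n^'n"
  assumes "symmetric_matrix M"
  shows "x \<bullet> (M *v y) = (M *v x) \<bullet> y"
  using assms unfolding symmetric_matrix_def
  by (metis dot_lmul_matrix vector_transpose_matrix)

lemma trace_eq_sum_axis: "trace (M::real^'n^'n) = (\<Sum>i\<in>UNIV. axis i 1 \<bullet> (M *v axis i 1))"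
  by (simp add: trace_def inner_axis' matrix_vector_mult_basis column_def)

text \<open>
  The form of $P$ is nonnegative along the line $v + t P v$.  If $Pv \neq 0$, its expansion at $t = 0$
  starts with the linear term $2t\,|Pv|^2$, so it would be negative for small negative $t$.
\<close>

lemma pos_semidef_null_vector:
  fixes P :: "real^'n^'n"
  assumes P: "pos_semidef P" and v: "v \<bullet> (P *v v) = 0"
  shows "P *v v = 0"
proof (rule ccontr)
  define w where "w = P *v v"
  define c where "c = w \<bullet> (P *v w)"
  \<comment> \<open>Close to the minimiser $-|w|^2/c$; adding 1 avoids the case $c = 0$.\<close>
  define t where "t = - (w \<bullet> w) / (c + 1)"
  assume "P *v v \<noteq> 0"
  then have w: "w \<bullet> w > 0" by (simp add: w_def)
  have c: "c \<ge> 0" using P by (simp add: c_def pos_semidef_def)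
  have "0 \<le> (v + t *\<^sub>R w) \<bullet> (P *v (v + t *\<^sub>R w))"
    using P by (simp add: pos_semidef_def)
  also have "\<dots> = 2 * t * (w \<bullet> w) + t^2 * c"
    using v symmetric_dot_commute[of P v w] P
    by (simp add: matvec.add_right matvec.scaleR_right inner_add_left inner_add_right w_def[symmetric]
        c_def pos_semidef_def power2_eq_square algebra_simps)
  also have "\<dots> = (w \<bullet> w)^2 / (c + 1) * (c / (c + 1) - 2)"
    by (simp add: t_def power2_eq_square right_diff_distrib)
  also have "\<dots> < 0"
    using w c by (intro mult_pos_neg) (auto simp: field_simps)
  finally show False by simp
qed

definition rank_one :: "real^'n \<Rightarrow> real^'n^'n" where
  "rank_one u = (\<chi> i j. u $ i * u $ j)"

lemma rank_one_mult_vec: "rank_one u *v x = (u \<bullet> x) *\<^sub>R u"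
  by (simp add: rank_one_def vec_eq_iff matrix_vector_mult_def inner_vec_def sum_distrib_left
      sum_distrib_right mult_ac)

lemma symmetric_rank_one: "symmetric_matrix (rank_one u)"
  by (simp add: rank_one_def symmetric_matrix_def transpose_def vec_eq_iff mult.commute)

lemma trace_rank_one_mult: "trace (rank_one u ** R) = u \<bullet> (R *v u)"
proof -
  have "trace (rank_one u ** R) = (\<Sum>i\<in>UNIV. \<Sum>k\<in>UNIV. u $ i * u $ k * R $ k $ i)"
    by (simp add: trace_def rank_one_def matrix_matrix_mult_def)
  also have "\<dots> = (\<Sum>k\<in>UNIV. \<Sum>i\<in>UNIV. u $ i * u $ k * R $ k $ i)"
    by (rule sum.swap)
  also have "\<dots> = u \<bullet> (R *v u)"
    by (simp add: inner_vec_def matrix_vector_mult_def sum_distrib_left mult_ac)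
  finally show ?thesis .
qed

text \<open>
  For $P$ of rank one, $P = u u^T$, the trace is $u^T R u$.  A general $P$ is reduced to this by a
  Cholesky step: if $q = v^T P v > 0$ then $P' = P - \frac1q (Pv)(Pv)^T$ is again positive
  semidefinite, and its kernel is larger because it also contains $v$.  Hence induction on the
  codimension of the kernel; it ends when the form of $P$ vanishes, that is, when $P = 0$.
\<close>

lemma trace_mult_pos_semidef_nonneg:
  fixes P R :: "real^'n^'n"
  assumes "pos_semidef P" and R: "pos_semidef R"
  shows "0 \<le> trace (P ** R)"
  using assms(1)
proof (induction "CARD('n) - dim {x. P *v x = 0}" arbitrary: P rule: less_induct)
  case less
  show ?case
  proof (cases "\<forall>v. v \<bullet> (P *v v) = 0")
    case True
    then have "\<forall>v. P *v v = 0" using pos_semidef_null_vector less.prems by blast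
    then have "P = 0" by (metis matrix_eq matvec.zero_left)
    then show ?thesis by (simp add: matmul.zero_left trace_linear)
  next
    case False
    then obtain v where "v \<bullet> (P *v v) \<noteq> 0" by blast
    moreover have "v \<bullet> (P *v v) \<ge> 0" using less.prems by (simp add: pos_semidef_def)
    ultimately have pos: "v \<bullet> (P *v v) > 0" by simp
    define q u where "q = v \<bullet> (P *v v)" and "u = P *v v"
    define P' where "P' = P - (1/q) *\<^sub>R rank_one u"
    have q: "q > 0" using pos by (simp add: q_def)
    have sym: "symmetric_matrix P" using less.prems by (simp add: pos_semidef_def)
    have P'x: "P' *v x = P *v x - ((u \<bullet> x) / q) *\<^sub>R u" for x
      by (simp add: P'_def matvec.diff_left matvec.scaleR_left rank_one_mult_vec)
    have "0 \<le> x \<bullet> (P' *v x)" for x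
    proof -
      \<comment> \<open>The form of $P'$ at $x$ is the minimum over $t$ of the form of $P$ at $x - t v$.\<close>
      define t where "t = (u \<bullet> x) / q"
      have vx: "v \<bullet> (P *v x) = u \<bullet> x"
        using symmetric_dot_commute[OF sym] by (simp add: u_def)
      have "0 \<le> (x - t *\<^sub>R v) \<bullet> (P *v (x - t *\<^sub>R v))"
        using less.prems by (simp add: pos_semidef_def)
      also have "\<dots> = x \<bullet> (P *v x) - 2 * t * (u \<bullet> x) + t^2 * q"
        using vx by (simp add: matvec.diff_right matvec.scaleR_right inner_diff_left inner_diff_right
            u_def[symmetric] q_def power2_eq_square inner_commute algebra_simps)
      also have "\<dots> = x \<bullet> (P' *v x)"
        using q by (simp add: P'x t_def inner_diff_right inner_commute field_simps power2_eq_square)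
      finally show ?thesis .
    qed
    moreover have "symmetric_matrix P'"
      using sym symmetric_rank_one[of u]
      by (simp add: P'_def symmetric_matrix_def transpose_linear)
    ultimately have psd: "pos_semidef P'" by (simp add: pos_semidef_def)
    have sub: "subspace {x. P *v x = 0}" "subspace {x. P' *v x = 0}"
      by (auto simp: subspace_def matvec.add_right matvec.scaleR_right matvec.zero_right)
    have "{x. P *v x = 0} \<subseteq> {x. P' *v x = 0}"
      using symmetric_dot_commute[OF sym] by (auto simp: P'x u_def) (metis inner_zero_right)
    moreover have "v \<in> {x. P' *v x = 0}" "v \<notin> {x. P *v x = 0}"
      using q by (auto simp: P'x u_def q_def inner_commute)
    ultimately have "{x. P *v x = 0} \<subset> {x. P' *v x = 0}" by blast
    then have "dim {x. P *v x = 0} < dim {x. P' *v x = 0}"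
      using sub by (metis dim_psubset span_eq_iff)
    moreover have "dim {x. P' *v x = 0} \<le> CARD('n)"
      using dim_subset_UNIV[of "{x. P' *v x = 0}"] by simp
    ultimately have "0 \<le> trace (P' ** R)"
      using less.hyps psd by simp
    moreover have "trace (P ** R) = trace (P' ** R) + (1/q) * (u \<bullet> (R *v u))"
      by (simp add: P'_def matmul.diff_left matmul.scaleR_left trace_linear trace_rank_one_mult)
    ultimately show ?thesis
      using q R by (simp add: pos_semidef_def)
  qed
qed

lemma pos_semidef_congruence:
  assumes R: "pos_semidef R" and K: "symmetric_matrix K"
  shows "pos_semidef (K ** R ** K)"
proof -
  have "transpose (K ** R ** K) = K ** R ** K"
    using assms by (simp add: matrix_transpose_mul matrix_mul_assoc pos_semidef_def symmetric_matrix_def)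
  moreover have "x \<bullet> ((K ** R ** K) *v x) = (K *v x) \<bullet> (R *v (K *v x))" for x
    using symmetric_dot_commute[OF K] by (simp add: matrix_vector_mul_assoc[symmetric])
  ultimately show ?thesis using R by (simp add: pos_semidef_def symmetric_matrix_def)
qed

text \<open>
  A minimiser $v$ of $x^T M x$ on the unit sphere makes $M - mI$ positive semidefinite, $m$ being the
  minimum, and $v$ is isotropic for this form, hence a null vector of it.
\<close>

lemma symmetric_matrix_min_eigenvector:
  fixes M :: "real^'n^'n"
  assumes "symmetric_matrix M"
  obtains m v where "v \<noteq> 0" "M *v v = m *\<^sub>R v" "pos_semidef (M - m *\<^sub>R mat 1)"
proof -
  have "continuous_on (sphere 0 1) (\<lambda>x. x \<bullet> (M *v x))"
    by (intro continuous_intros linear_continuous_on matvec.bounded_linear_right)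
  moreover have "sphere (0::real^'n) 1 \<noteq> {}" by simp
  ultimately obtain v where "v \<in> sphere 0 1" and "\<forall>x\<in>sphere 0 1. v \<bullet> (M *v v) \<le> x \<bullet> (M *v x)"
    using continuous_attains_inf[OF compact_sphere] by blast
  then have v: "norm v = 1" and min: "\<And>x. norm x = 1 \<Longrightarrow> v \<bullet> (M *v v) \<le> x \<bullet> (M *v x)"
    by auto
  define m where "m = v \<bullet> (M *v v)"
  let ?N = "M - m *\<^sub>R mat 1"
  have N: "?N *v x = M *v x - m *\<^sub>R x" for x
    by (simp add: matvec.diff_left matvec.scaleR_left)
  have "0 \<le> x \<bullet> (?N *v x)" for x
  proof (cases "x = 0")
    case False
    define u where "u = (1 / norm x) *\<^sub>R x"
    have x: "x = norm x *\<^sub>R u" and "norm u = 1" using False by (simp_all add: u_def)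
    have "m \<le> u \<bullet> (M *v u)" using min[OF \<open>norm u = 1\<close>] by (simp add: m_def)
    moreover have "u \<bullet> u = 1" using \<open>norm u = 1\<close> by (simp add: dot_square_norm)
    ultimately have "0 \<le> u \<bullet> (?N *v u)" by (simp add: N inner_diff_right)
    then have "0 \<le> (norm x *\<^sub>R u) \<bullet> (?N *v (norm x *\<^sub>R u))"
      by (simp add: matvec.scaleR_right)
    then show ?thesis by (simp flip: x)
  qed simp
  moreover have "symmetric_matrix ?N"
    using assms by (simp add: symmetric_matrix_def transpose_linear transpose_mat)
  ultimately have psd: "pos_semidef ?N" by (simp add: pos_semidef_def)
  have "v \<bullet> (?N *v v) = 0" using v unfolding N by (simp add: inner_diff_right m_def dot_square_norm)
  then have "M *v v = m *\<^sub>R v" using pos_semidef_null_vector[OF psd] by (simp add: N)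
  moreover have "v \<noteq> 0" using v by auto
  ultimately show ?thesis using psd that by blast
qed

text \<open>
  Eigenvectors for different eigenvalues are orthogonal, hence independent.  Finiteness makes the
  minimum in the definition of \<open>lambda_min\<close> a lower bound for every eigenvalue.
\<close>

lemma finite_eigenvalues_symmetric:
  fixes M :: "real^'n^'n"
  assumes sym: "symmetric_matrix M"
  shows "finite (eigenvalues M)"
proof -
  define e where "e c = (SOME v. v \<noteq> 0 \<and> M *v v = c *\<^sub>R v)" for c
  have e: "e c \<noteq> 0 \<and> M *v e c = c *\<^sub>R e c" if "c \<in> eigenvalues M" for c
    using that unfolding e_def eigenvalues_def mem_Collect_eq by (rule someI_ex)
  have orth: "orthogonal (e c) (e d)" if "c \<in> eigenvalues M" "d \<in> eigenvalues M" "c \<noteq> d" for c d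
  proof -
    have "d * (e c \<bullet> e d) = c * (e c \<bullet> e d)"
      using symmetric_dot_commute[OF sym, of "e c" "e d"] e that by simp
    then show ?thesis using that by (simp add: orthogonal_def)
  qed
  have "inj_on e (eigenvalues M)"
    by (rule inj_onI) (metis e orth orthogonal_self)
  moreover have "pairwise orthogonal (e ` eigenvalues M)"
    by (auto simp: pairwise_def intro: orth)
  then have "independent (e ` eigenvalues M)"
    by (rule pairwise_orthogonal_independent) (use e in auto)
  then have "finite (e ` eigenvalues M)" by (rule independent_imp_finite)
  ultimately show ?thesis using finite_imageD by blast
qed

section \<open>Powers of a matrix and their derivatives\<close>

primrec matrix_power :: "real^'n^'n \<Rightarrow> nat \<Rightarrow> real^'n^'n" where
  "matrix_power M 0 = mat 1"
| "matrix_power M (Suc k) = M ** matrix_power M k"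

lemma matrix_power_eq_funpow: "matrix_power M k = ((\<lambda>P. M ** P) ^^ k) (mat 1)"
  by (induction k) auto

lemma matrix_power_add: "matrix_power M (j + k) = matrix_power M j ** matrix_power M k"
  by (induction j) (simp_all add: matrix_mul_assoc)

lemma matrix_power_Suc_right: "matrix_power M (Suc k) = matrix_power M k ** M"
  using matrix_power_add[of M k 1] by simp

lemma symmetric_matrix_power:
  assumes "symmetric_matrix M" shows "symmetric_matrix (matrix_power M k)"
proof (induction k)
  case (Suc k)
  have "transpose (M ** matrix_power M k) = matrix_power M k ** M"
    using assms Suc by (simp add: matrix_transpose_mul symmetric_matrix_def)
  then show ?case
    using matrix_power_Suc_right[of M k] by (simp add: symmetric_matrix_def)
qed (simp add: symmetric_matrix_def transpose_mat)

lemma pos_semidef_mat_1: "pos_semidef (mat 1)"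
  by (simp add: pos_semidef_def symmetric_matrix_def transpose_mat)

text \<open>
  With $j = \lfloor k/2 \rfloor$, the power $N^k$ is $N^j I N^j$ or $N^j N N^j$.
\<close>

lemma pos_semidef_matrix_power:
  assumes N: "pos_semidef N" shows "pos_semidef (matrix_power N k)"
proof -
  define j where "j = k div 2"
  have K: "symmetric_matrix (matrix_power N j)"
    using N by (intro symmetric_matrix_power) (simp add: pos_semidef_def)
  show ?thesis
  proof (cases "even k")
    case True
    then have "k = j + j" by (auto simp: j_def)
    then have "matrix_power N k = matrix_power N j ** mat 1 ** matrix_power N j"
      by (simp add: matrix_power_add)
    then show ?thesis using pos_semidef_congruence[OF pos_semidef_mat_1 K] by simp
  next
    case False
    then have "k = Suc j + j" unfolding j_def by presburger
    then have "matrix_power N k = matrix_power N j ** N ** matrix_power N j"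
      by (simp only: matrix_power_add matrix_power_Suc_right)
    then show ?thesis using pos_semidef_congruence[OF N K] by simp
  qed
qed

definition matrix_power_deriv :: "real^'n^'n \<Rightarrow> nat \<Rightarrow> real^'n^'n \<Rightarrow> real^'n^'n" where
  "matrix_power_deriv M k H = (\<Sum>j<k. matrix_power M j ** H ** matrix_power M (k - Suc j))"

lemma matrix_power_deriv_Suc:
  "matrix_power_deriv M (Suc k) H = matrix_power M k ** H + matrix_power_deriv M k H ** M"
proof -
  have "matrix_power M j ** H ** matrix_power M (k - j)
      = matrix_power M j ** H ** matrix_power M (k - Suc j) ** M" if "j < k" for j
  proof -
    have "k - j = Suc (k - Suc j)" using that by simp
    then show ?thesis by (metis matrix_power_Suc_right matrix_mul_assoc)
  qed
  then show ?thesis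
    by (simp add: matrix_power_deriv_def matmul.sum_left)
qed

lemma has_derivative_matrix_power:
  "((\<lambda>M. matrix_power M k) has_derivative matrix_power_deriv M k) (at M)"
proof (induction k)
  case 0
  have "matrix_power_deriv M 0 = (\<lambda>H. 0)" by (simp add: matrix_power_deriv_def fun_eq_iff)
  then show ?case by simp
next
  case (Suc k)
  have "((\<lambda>M. matrix_power M k ** M) has_derivative
      (\<lambda>H. matrix_power M k ** H + matrix_power_deriv M k H ** M)) (at M)"
    using matmul.FDERIV[OF Suc has_derivative_ident] by simp
  then show ?case
    by (simp only: matrix_power_Suc_right matrix_power_deriv_Suc[abs_def])
qed

text \<open>
  One constant $B$ serves for the whole ball, which is what the uniform convergence of the series
  below needs.  The factor by which the product may fail to be submultiplicative is absorbed
  into $B$.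
\<close>

lemma norm_matrix_power_le:
  "\<exists>B\<ge>1. \<forall>(M::real^'n^'n) k. norm M \<le> r \<longrightarrow> norm (matrix_power M k) \<le> B ^ Suc k"
proof -
  obtain K where "K > 0" "\<forall>(P::real^'n^'n) (Q::real^'n^'n). norm (P ** Q) \<le> norm P * norm Q * K"
    using matmul.pos_bounded by blast
  then have K: "K > 0" "norm (P ** Q) \<le> norm P * norm Q * K" for P Q :: "real^'n^'n"
    by blast+
  define B where "B = 1 + norm (mat 1 :: real^'n^'n) + \<bar>r\<bar> * K"
  have B: "B \<ge> 1" "norm (mat 1 :: real^'n^'n) \<le> B" "\<bar>r\<bar> * K \<le> B"
    using K(1) by (simp_all add: B_def)
  have "norm (matrix_power M k) \<le> B ^ Suc k" if M: "norm M \<le> r" for M :: "real^'n^'n" and k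
  proof (induction k)
    case (Suc k)
    have "norm (matrix_power M (Suc k)) \<le> (norm M * K) * norm (matrix_power M k)"
      using K(2)[of M "matrix_power M k"] by (simp add: mult_ac)
    also have "\<dots> \<le> B * B ^ Suc k"
    proof (intro mult_mono Suc)
      have "norm M * K \<le> \<bar>r\<bar> * K" using M K(1) by (intro mult_right_mono) auto
      then show "norm M * K \<le> B" using B(3) by simp
    qed (use B(1) in auto)
    finally show ?case by simp
  qed (use B in simp)
  with B(1) show ?thesis by blast
qed

section \<open>The matrix exponential and its derivative\<close>

lemma matrix_exp_sums: "(\<lambda>k. (1 / fact k) *\<^sub>R matrix_power M k) sums matrix_exp M"
proof -
  obtain B where B: "B \<ge> 1" "\<And>k. norm (matrix_power M k) \<le> B ^ Suc k"
    using norm_matrix_power_le[of "norm M"] by (elim exE conjE) blast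
  have "summable (\<lambda>k. B * (inverse (fact k) * B ^ k))"
    by (intro summable_mult summable_exp)
  moreover have "norm ((1 / fact k) *\<^sub>R matrix_power M k) \<le> B * (inverse (fact k) * B ^ k)" for k
    using B(2)[of k] by (simp add: field_simps)
  ultimately have "summable (\<lambda>k. (1 / fact k) *\<^sub>R matrix_power M k)"
    by (rule summable_comparison_test'[where N=0])
  then show ?thesis
    unfolding matrix_exp_def matrix_power_eq_funpow by (rule summable_sums)
qed

definition matrix_exp_deriv :: "real^'n^'n \<Rightarrow> real^'n^'n \<Rightarrow> real^'n^'n" where
  "matrix_exp_deriv M H = (\<Sum>k. (1 / fact k) *\<^sub>R matrix_power_deriv M k H)"

text \<open>
  A Weierstrass majorant, uniform on a ball and relative to $|H|$, for the termwise differentiated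
  exponential series.
\<close>

lemma matrix_exp_deriv_majorant:
  "\<exists>c :: nat \<Rightarrow> real. summable c \<and> (\<forall>k (M::real^'n^'n) (H::real^'n^'n). norm M \<le> r \<longrightarrow>
     norm ((1 / fact k) *\<^sub>R matrix_power_deriv M k H) \<le> c k * norm H)"
proof -
  obtain K where "K > 0" "\<forall>(P::real^'n^'n) (Q::real^'n^'n). norm (P ** Q) \<le> norm P * norm Q * K"
    using matmul.pos_bounded by blast
  then have K: "K > 0" "norm (P ** Q) \<le> norm P * norm Q * K" for P Q :: "real^'n^'n"
    by blast+
  obtain B where "B \<ge> 1"
    "\<forall>(M::real^'n^'n) k. norm M \<le> r \<longrightarrow> norm (matrix_power M k) \<le> B ^ Suc k"
    using norm_matrix_power_le by blast
  then have B: "B \<ge> 1" "norm M \<le> r \<Longrightarrow> norm (matrix_power M k) \<le> B ^ Suc k"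
    for M :: "real^'n^'n" and k
    by blast+
  define c where "c k = K^2 * B * (inverse (fact k) * (2 * B) ^ k)" for k
  have "summable c"
    unfolding c_def by (intro summable_mult summable_exp)
  moreover have "norm ((1 / fact k) *\<^sub>R matrix_power_deriv M k H) \<le> c k * norm H"
    if M: "norm M \<le> r" for k and M H :: "real^'n^'n"
  proof -
    have "norm (matrix_power M j ** H ** matrix_power M (k - Suc j)) \<le> K^2 * B ^ Suc k * norm H"
      if "j < k" for j
    proof -
      have "norm (matrix_power M j ** H ** matrix_power M (k - Suc j))
          \<le> (norm (matrix_power M j) * norm H * K) * norm (matrix_power M (k - Suc j)) * K"
        using K(1) by (intro order_trans[OF K(2)] mult_right_mono K(2)) auto
      also have "\<dots> \<le> (B ^ Suc j * norm H * K) * B ^ Suc (k - Suc j) * K"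
        using K(1) B(1) B(2)[OF M] by (intro mult_mono) auto
      also have "\<dots> = K^2 * (B ^ (Suc j + Suc (k - Suc j))) * norm H"
        by (simp only: power_add power2_eq_square mult_ac)
      also have "Suc j + Suc (k - Suc j) = Suc k" using that by simp
      finally show ?thesis .
    qed
    then have "norm (matrix_power_deriv M k H) \<le> real k * (K^2 * B ^ Suc k * norm H)"
      unfolding matrix_power_deriv_def
      by (intro order_trans[OF norm_sum] order_trans[OF sum_bounded_above]) auto
    \<comment> \<open>Trading the factor $k$ for $2^k$ turns the majorant into an exponential series.\<close>
    also have "\<dots> \<le> 2 ^ k * (K^2 * B ^ Suc k * norm H)"
      using K(1) B(1) by (intro mult_right_mono) (auto intro: less_imp_le of_nat_less_two_power)
    finally show ?thesis
      by (simp add: c_def power_mult_distrib field_simps)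
  qed
  ultimately show ?thesis by blast
qed

lemma matrix_exp_deriv_sums:
  "(\<lambda>k. (1 / fact k) *\<^sub>R matrix_power_deriv M k H) sums matrix_exp_deriv M H"
proof -
  obtain c where c: "summable c"
    "\<And>k. norm ((1 / fact k) *\<^sub>R matrix_power_deriv M k H) \<le> c k * norm H"
    using matrix_exp_deriv_majorant[of "norm M"] by (elim exE conjE) blast
  have "summable (\<lambda>k. c k * norm H)" using c(1) by (rule summable_mult2)
  then have "summable (\<lambda>k. (1 / fact k) *\<^sub>R matrix_power_deriv M k H)"
    using c(2) by (rule summable_comparison_test')
  then show ?thesis unfolding matrix_exp_deriv_def by (rule summable_sums)
qed

text \<open>
  Termwise differentiation on a ball around $M$, where the majorant makes the differentiated series
  converge uniformly.
\<close>

lemma has_derivative_matrix_exp: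
  fixes M :: "real^'n^'n"
  shows "(matrix_exp has_derivative matrix_exp_deriv M) (at M)"
proof -
  define r where "r = norm M + 1"
  let ?S = "ball 0 r :: (real^'n^'n) set"
  obtain c where "summable c" "\<forall>k (M::real^'n^'n) (H::real^'n^'n). norm M \<le> r \<longrightarrow>
       norm ((1 / fact k) *\<^sub>R matrix_power_deriv M k H) \<le> c k * norm H"
    using matrix_exp_deriv_majorant by blast
  then have c: "summable c" "norm M \<le> r \<Longrightarrow>
       norm ((1 / fact k) *\<^sub>R matrix_power_deriv M k H) \<le> c k * norm H"
    for k and M H :: "real^'n^'n"
    by blast+
  have M: "M \<in> ?S" by (simp add: r_def)
  have "\<exists>g. \<forall>x\<in>?S. (\<lambda>k. (1 / fact k) *\<^sub>R matrix_power x k) sums g x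
      \<and> (g has_derivative matrix_exp_deriv x) (at x within ?S)"
  proof (rule has_derivative_series[where f = "\<lambda>k x. (1 / fact k) *\<^sub>R matrix_power x k"
        and f' = "\<lambda>k x H. (1 / fact k) *\<^sub>R matrix_power_deriv x k H",
        OF convex_ball _ _ M matrix_exp_sums])
    show "((\<lambda>x. (1 / fact k) *\<^sub>R matrix_power x k) has_derivative
        (\<lambda>H. (1 / fact k) *\<^sub>R matrix_power_deriv x k H)) (at x within ?S)" for k x
      by (rule has_derivative_at_withinI[OF has_derivative_scaleR_right[OF has_derivative_matrix_power]])
    show "\<forall>\<^sub>F n in sequentially. \<forall>x\<in>?S. \<forall>H.
        norm ((\<Sum>k<n. (1 / fact k) *\<^sub>R matrix_power_deriv x k H) - matrix_exp_deriv x H) \<le> e * norm H"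
      if "e > 0" for e :: real
    proof -
      have "(\<lambda>n. sum c {..<n}) \<longlonglongrightarrow> suminf c" using c(1) by (rule summable_LIMSEQ)
      then have "\<forall>\<^sub>F n in sequentially. dist (sum c {..<n}) (suminf c) < e"
        using \<open>e > 0\<close> by (rule tendstoD)
      then show ?thesis
      proof eventually_elim
        case (elim n)
        show ?case
        proof (intro ballI allI)
          fix x H assume "x \<in> ?S"
          then have x: "norm x \<le> r" by simp
          let ?u = "\<lambda>k. (1 / fact k) *\<^sub>R matrix_power_deriv x k H"
          have u: "summable ?u" using matrix_exp_deriv_sums by (rule sums_summable)
          have cH: "summable (\<lambda>k. c (k + n) * norm H)"
            using c(1) by (intro summable_mult2) (simp add: summable_iff_shift)
          have "norm ((\<Sum>k<n. ?u k) - matrix_exp_deriv x H) = norm (\<Sum>k. ?u (k + n))"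
            using suminf_split_initial_segment[OF u, of n]
            by (simp add: matrix_exp_deriv_def norm_minus_commute)
          also have "\<dots> \<le> (\<Sum>k. c (k + n) * norm H)"
            by (rule norm_suminf_le[OF c(2)[OF x] cH])
          also have "\<dots> = (suminf c - sum c {..<n}) * norm H"
            using suminf_split_initial_segment[OF c(1), of n] c(1)
            by (subst suminf_mult2[symmetric]) (simp_all add: summable_iff_shift)
          also have "\<dots> \<le> e * norm H"
            using elim by (intro mult_right_mono) (auto simp: dist_real_def)
          finally show "norm ((\<Sum>k<n. ?u k) - matrix_exp_deriv x H) \<le> e * norm H" .
        qed
      qed
    qed
  qed
  then obtain g where g: "\<And>x. x \<in> ?S \<Longrightarrow> (\<lambda>k. (1 / fact k) *\<^sub>R matrix_power x k) sums g x"
      "\<And>x. x \<in> ?S \<Longrightarrow> (g has_derivative matrix_exp_deriv x) (at x within ?S)"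
    by blast
  have "g x = matrix_exp x" if "x \<in> ?S" for x
    using g(1)[OF that] matrix_exp_sums by (rule sums_unique2)
  then have "(matrix_exp has_derivative matrix_exp_deriv M) (at M within ?S)"
    by (intro has_derivative_transform[OF M _ g(2)[OF M]]) simp
  then show ?thesis
    using M by (simp add: at_within_open[OF _ open_ball])
qed

lemmas trace_sum = linear_sum[OF bounded_linear.linear[OF bounded_linear_trace]]

text \<open>
  Under the trace all summands of the derivative of a power agree, by cyclicity.
\<close>

lemma trace_matrix_power_deriv_Suc:
  "trace (matrix_power_deriv M (Suc k) H) = real (Suc k) * trace (matrix_power M k ** H)"
proof -
  have "trace (matrix_power M j ** H ** matrix_power M (Suc k - Suc j)) = trace (matrix_power M k ** H)"
    if "j < Suc k" for j
  proof -
    have "trace (matrix_power M j ** H ** matrix_power M (Suc k - Suc j))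
        = trace (matrix_power M (k - j) ** matrix_power M j ** H)"
      by (subst trace_mul_sym) (simp add: matrix_mul_assoc)
    then show ?thesis using that by (simp flip: matrix_power_add)
  qed
  then have "trace (matrix_power_deriv M (Suc k) H) = (\<Sum>j<Suc k. trace (matrix_power M k ** H))"
    unfolding matrix_power_deriv_def trace_sum by (intro sum.cong) auto
  then show ?thesis by simp
qed

text \<open>
  The identity commutes with $M$, so in this direction the rule of scalar calculus holds.
\<close>

lemma matrix_power_deriv_mat_1_Suc:
  "matrix_power_deriv M (Suc k) (mat 1) = real (Suc k) *\<^sub>R matrix_power M k"
proof -
  have "matrix_power_deriv M (Suc k) (mat 1) = (\<Sum>j<Suc k. matrix_power M k)"
    unfolding matrix_power_deriv_def by (intro sum.cong) (auto simp flip: matrix_power_add)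
  then show ?thesis by (simp only: sum_constant_scaleR card_lessThan)
qed

text \<open>
  Cyclicity exchanges $P$ and $Q$ while turning the index $j$ into $k - 1 - j$.
\<close>

lemma trace_matrix_power_deriv_commute:
  "trace (matrix_power_deriv M k P ** Q) = trace (matrix_power_deriv M k Q ** P)"
proof -
  let ?p = "matrix_power M"
  have "trace (matrix_power_deriv M k P ** Q) = (\<Sum>j<k. trace (?p j ** P ** ?p (k - Suc j) ** Q))"
    by (simp add: matrix_power_deriv_def matmul.sum_left trace_sum)
  also have "\<dots> = (\<Sum>j<k. trace (?p (k - Suc j) ** Q ** ?p (k - Suc (k - Suc j)) ** P))"
  proof (rule sum.cong)
    fix j assume "j \<in> {..<k}"
    then have "k - Suc (k - Suc j) = j" by auto
    then show "trace (?p j ** P ** ?p (k - Suc j) ** Q)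
        = trace (?p (k - Suc j) ** Q ** ?p (k - Suc (k - Suc j)) ** P)"
      using trace_mul_sym[of "?p j ** P" "?p (k - Suc j) ** Q"] by (simp add: matrix_mul_assoc)
  qed simp
  also have "\<dots> = (\<Sum>j<k. trace (?p j ** Q ** ?p (k - Suc j) ** P))"
    by (rule sum.nat_diff_reindex)
  also have "\<dots> = trace (matrix_power_deriv M k Q ** P)"
    by (simp add: matrix_power_deriv_def matmul.sum_left trace_sum)
  finally show ?thesis .
qed

lemma trace_matrix_exp_deriv: "trace (matrix_exp_deriv M H) = trace (matrix_exp M ** H)"
proof -
  let ?f = "\<lambda>k. trace ((1 / fact k) *\<^sub>R matrix_power_deriv M k H)"
  have "?f sums trace (matrix_exp_deriv M H)"
    by (rule bounded_linear.sums[OF bounded_linear_trace matrix_exp_deriv_sums])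
  moreover have "?f 0 = 0" by (simp add: matrix_power_deriv_def trace_linear)
  moreover have "?f (Suc k) = trace (((1 / fact k) *\<^sub>R matrix_power M k) ** H)" for k
    by (simp add: trace_linear trace_matrix_power_deriv_Suc matmul.scaleR_left del: of_nat_Suc)
  ultimately have "(\<lambda>k. trace (((1 / fact k) *\<^sub>R matrix_power M k) ** H)) sums trace (matrix_exp_deriv M H)"
    using sums_Suc_iff[of ?f "trace (matrix_exp_deriv M H)"] by simp
  moreover have "(\<lambda>k. trace (((1 / fact k) *\<^sub>R matrix_power M k) ** H)) sums trace (matrix_exp M ** H)"
    by (intro bounded_linear.sums[OF bounded_linear_trace]
        bounded_linear.sums[OF matmul.bounded_linear_left] matrix_exp_sums)
  ultimately show ?thesis by (rule sums_unique2)
qed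

lemma matrix_exp_deriv_mat_1: "matrix_exp_deriv M (mat 1) = matrix_exp M"
proof -
  let ?f = "\<lambda>k. (1 / fact k) *\<^sub>R matrix_power_deriv M k (mat 1)"
  have "?f 0 = 0" by (simp add: matrix_power_deriv_def)
  moreover have "?f (Suc k) = (1 / fact k) *\<^sub>R matrix_power M k" for k
    by (simp add: matrix_power_deriv_mat_1_Suc del: of_nat_Suc)
  ultimately have "(\<lambda>k. (1 / fact k) *\<^sub>R matrix_power M k) sums matrix_exp_deriv M (mat 1)"
    using matrix_exp_deriv_sums[of M "mat 1"] sums_Suc_iff[of ?f "matrix_exp_deriv M (mat 1)"] by simp
  then show ?thesis using matrix_exp_sums by (rule sums_unique2)
qed

lemma trace_matrix_exp_deriv_sums:
  "(\<lambda>k. (1 / fact k) * trace (matrix_power_deriv M k P ** Q)) sums trace (matrix_exp_deriv M P ** Q)"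
proof -
  have "(\<lambda>k. trace (((1 / fact k) *\<^sub>R matrix_power_deriv M k P) ** Q)) sums trace (matrix_exp_deriv M P ** Q)"
    by (intro bounded_linear.sums[OF bounded_linear_trace]
        bounded_linear.sums[OF matmul.bounded_linear_left] matrix_exp_deriv_sums)
  then show ?thesis by (simp add: matmul.scaleR_left trace_linear)
qed

lemma trace_matrix_exp_deriv_commute:
  "trace (matrix_exp_deriv M P ** Q) = trace (matrix_exp_deriv M Q ** P)"
proof -
  have "(\<lambda>k. (1 / fact k) * trace (matrix_power_deriv M k P ** Q)) sums trace (matrix_exp_deriv M Q ** P)"
    unfolding trace_matrix_power_deriv_commute[of M _ P Q] by (rule trace_matrix_exp_deriv_sums)
  with trace_matrix_exp_deriv_sums[of M P Q] show ?thesis by (rule sums_unique2)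
qed

lemma bounded_linear_matrix_exp_deriv: "bounded_linear (matrix_exp_deriv M)"
  by (rule has_derivative_bounded_linear[OF has_derivative_matrix_exp])

lemma symmetric_matrix_exp:
  assumes "symmetric_matrix M" shows "symmetric_matrix (matrix_exp M)"
proof -
  have "(\<lambda>k. transpose ((1 / fact k) *\<^sub>R matrix_power M k)) sums transpose (matrix_exp M)"
    by (rule bounded_linear.sums[OF bounded_linear_transpose matrix_exp_sums])
  then have "(\<lambda>k. (1 / fact k) *\<^sub>R matrix_power M k) sums transpose (matrix_exp M)"
    using symmetric_matrix_power[OF assms] by (simp add: transpose_linear symmetric_matrix_def)
  then show ?thesis
    unfolding symmetric_matrix_def using matrix_exp_sums by (rule sums_unique2)
qed

text \<open>
  The function $t \mapsto e^{-t} \exp(N + tI)$ has derivative zero, because the derivative of $\exp$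
  at any point in the direction $I$ is $\exp$ itself.
\<close>

lemma matrix_exp_add_scalar:
  fixes N :: "real^'n^'n"
  shows "matrix_exp (N + m *\<^sub>R mat 1) = exp m *\<^sub>R matrix_exp N"
proof -
  define E where "E t = matrix_exp (N + t *\<^sub>R mat 1)" for t
  have E: "(E has_derivative (\<lambda>s. s *\<^sub>R E t)) (at t)" for t
  proof -
    have "((\<lambda>t. N + t *\<^sub>R mat 1) has_derivative (\<lambda>s. s *\<^sub>R mat 1)) (at t)"
      by (auto intro!: derivative_eq_intros)
    from has_derivative_compose[OF this has_derivative_matrix_exp] show ?thesis
      by (simp add: E_def[abs_def] linear_simps[OF bounded_linear_matrix_exp_deriv] matrix_exp_deriv_mat_1)
  qed
  have "((\<lambda>t. exp (- t) *\<^sub>R E t) has_derivative (\<lambda>s. 0)) (at t within UNIV)" for t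
    by (auto intro!: derivative_eq_intros E)
  then have "exp (- m) *\<^sub>R E m = exp (- 0) *\<^sub>R E 0"
    by (rule has_derivative_zero_unique[where f = "\<lambda>t. exp (- t) *\<^sub>R E t", OF convex_UNIV]) simp_all
  then have "exp m *\<^sub>R (exp (- m) *\<^sub>R E m) = exp m *\<^sub>R E 0" by simp
  then show ?thesis by (simp add: E_def flip: exp_add)
qed

lemma matrix_exp_deriv_add_scalar:
  fixes N :: "real^'n^'n"
  shows "matrix_exp_deriv (N + m *\<^sub>R mat 1) H = exp m *\<^sub>R matrix_exp_deriv N H"
proof -
  have "((\<lambda>P. P + m *\<^sub>R mat 1) has_derivative (\<lambda>H. H)) (at N)"
    by (auto intro!: derivative_eq_intros)
  from has_derivative_compose[OF this has_derivative_matrix_exp]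
  have "((\<lambda>P. exp m *\<^sub>R matrix_exp P) has_derivative matrix_exp_deriv (N + m *\<^sub>R mat 1)) (at N)"
    by (simp add: matrix_exp_add_scalar)
  moreover have "((\<lambda>P. exp m *\<^sub>R matrix_exp P) has_derivative (\<lambda>H. exp m *\<^sub>R matrix_exp_deriv N H)) (at N)"
    by (rule has_derivative_scaleR_right[OF has_derivative_matrix_exp])
  ultimately show ?thesis by (rule has_derivative_unique[THEN fun_cong])
qed

section \<open>Lower bounds for the exponential and its derivative\<close>

text \<open>
  The heart of the argument: for positive semidefinite $N$ the series on the right has nonnegative
  terms, and the term of index 1 is the left-hand side.
\<close>

lemma trace_matrix_exp_deriv_pos_semidef:
  assumes N: "pos_semidef N" and H: "symmetric_matrix H"
  shows "trace (H ** H) \<le> trace (matrix_exp_deriv N H ** H)"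
proof -
  let ?f = "\<lambda>k. (1 / fact k) * trace (matrix_power_deriv N k H ** H)"
  have "0 \<le> ?f k" for k
  proof -
    have "0 \<le> trace (matrix_power N j ** H ** matrix_power N (k - Suc j) ** H)" for j
    proof -
      have "0 \<le> trace (matrix_power N j ** (H ** matrix_power N (k - Suc j) ** H))"
        by (intro trace_mult_pos_semidef_nonneg pos_semidef_congruence pos_semidef_matrix_power N H)
      then show ?thesis by (simp add: matrix_mul_assoc)
    qed
    then show ?thesis
      by (simp add: matrix_power_deriv_def matmul.sum_left trace_sum sum_nonneg)
  qed
  then have "sum ?f {1} \<le> suminf ?f"
    using trace_matrix_exp_deriv_sums by (intro sum_le_suminf) (auto simp: sums_iff)
  also have "suminf ?f = trace (matrix_exp_deriv N H ** H)"
    using trace_matrix_exp_deriv_sums by (rule sums_unique[symmetric])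
  finally show ?thesis by (simp add: matrix_power_deriv_def)
qed

lemma matrix_exp_mult_vec_sums:
  "(\<lambda>k. (1 / fact k) *\<^sub>R (matrix_power M k *v x)) sums (matrix_exp M *v x)"
  using bounded_linear.sums[OF matvec.bounded_linear_left matrix_exp_sums]
  by (simp add: matvec.scaleR_left)

text \<open>
  Again a series with nonnegative terms, compared with its term of index 0.
\<close>

lemma matrix_exp_pos_semidef_ge:
  assumes N: "pos_semidef N"
  shows "x \<bullet> x \<le> x \<bullet> (matrix_exp N *v x)"
proof -
  let ?f = "\<lambda>k. (1 / fact k) * (x \<bullet> (matrix_power N k *v x))"
  have s: "?f sums (x \<bullet> (matrix_exp N *v x))"
    using bounded_linear.sums[OF bounded_linear_inner_right matrix_exp_mult_vec_sums] by simp
  have "0 \<le> ?f k" for k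
    using pos_semidef_matrix_power[OF N] by (simp add: pos_semidef_def)
  then have "sum ?f {0} \<le> suminf ?f"
    using s by (intro sum_le_suminf) (auto simp: sums_iff)
  then show ?thesis using s by (simp add: sums_iff)
qed

lemma matrix_exp_null_vector:
  assumes "N *v v = 0" shows "matrix_exp N *v v = v"
proof -
  let ?f = "\<lambda>k. (1 / fact k) *\<^sub>R (matrix_power N k *v v)"
  have "?f k = 0" if k: "k \<notin> {0}" for k
  proof -
    obtain j where "k = Suc j" using k not0_implies_Suc[of k] by auto
    then show ?thesis
      using assms by (simp add: matrix_power_Suc_right matrix_vector_mul_assoc[symmetric] matvec.zero_right
          del: matrix_power.simps)
  qed
  then have "?f sums sum ?f {0}" by (intro sums_finite) auto
  with matrix_exp_mult_vec_sums have "matrix_exp N *v v = sum ?f {0}" by (rule sums_unique2)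
  then show ?thesis by simp
qed

text \<open>
  The bounds for the positive semidefinite matrix $N = M - mI$, transported to $M$ by the factor
  $\mu = e^m$.
\<close>

lemma symmetric_matrix_exp_min_eigenvalue:
  fixes M :: "real^'n^'n"
  assumes "symmetric_matrix M"
  obtains \<mu> where "\<mu> > 0" "\<mu> \<in> eigenvalues (matrix_exp M)"
    "\<And>x. \<mu> * (x \<bullet> x) \<le> x \<bullet> (matrix_exp M *v x)"
    "\<And>H. symmetric_matrix H \<Longrightarrow> \<mu> * trace (H ** H) \<le> trace (matrix_exp_deriv M H ** H)"
proof -
  obtain m v where v: "v \<noteq> 0" "M *v v = m *\<^sub>R v" and psd: "pos_semidef (M - m *\<^sub>R mat 1)"
    using symmetric_matrix_min_eigenvector[OF assms] by blast
  define N where "N = M - m *\<^sub>R mat 1"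
  have N: "pos_semidef N" using psd by (simp add: N_def)
  have M: "M = N + m *\<^sub>R mat 1" by (simp add: N_def)
  have "N *v v = 0" using v by (simp add: N_def matvec.diff_left matvec.scaleR_left)
  then have "matrix_exp M *v v = exp m *\<^sub>R v"
    by (simp add: M matrix_exp_add_scalar matvec.scaleR_left matrix_exp_null_vector)
  then have "exp m \<in> eigenvalues (matrix_exp M)" using v by (auto simp: eigenvalues_def)
  moreover have "exp m * (x \<bullet> x) \<le> x \<bullet> (matrix_exp M *v x)" for x
    using matrix_exp_pos_semidef_ge[OF N] by (simp add: M matrix_exp_add_scalar matvec.scaleR_left)
  moreover have "exp m * trace (H ** H) \<le> trace (matrix_exp_deriv M H ** H)"
    if "symmetric_matrix H" for H
    using trace_matrix_exp_deriv_pos_semidef[OF N that]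
    by (simp add: M matrix_exp_deriv_add_scalar matmul.scaleR_left trace_linear)
  ultimately show ?thesis using that[of "exp m"] by simp
qed

section \<open>Gradient and Hessian of the log-trace-exponential function\<close>

lemma bounded_linear_lin_comb: "bounded_linear (lin_comb A)"
  by (intro linear_conv_bounded_linear[THEN iffD1] linearI)
     (auto simp: lin_comb_def sum.distrib scaleR_sum_right scaleR_add_left)

lemma symmetric_lin_comb:
  assumes "\<And>i. symmetric_matrix (A i)" shows "symmetric_matrix (lin_comb A y)"
  using assms
  by (simp add: symmetric_matrix_def lin_comb_def transpose_linear
      linear_sum[OF bounded_linear.linear[OF bounded_linear_transpose]])

lemma bounded_linear_apply_lin_comb:
  assumes "bounded_linear \<phi>"
  shows "\<phi> (lin_comb A x) = (\<Sum>i\<in>UNIV. x $ i *\<^sub>R \<phi> (A i))"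
  by (simp add: lin_comb_def linear_sum[OF bounded_linear.linear[OF assms]] linear_simps(5)[OF assms])

lemma bounded_linear_trace_mult: "bounded_linear (\<lambda>P. trace (P ** (Q::real^'n^'n)))"
  by (rule bounded_linear_compose[OF bounded_linear_trace matmul.bounded_linear_left])

lemma bounded_linear_trace_mult_right: "bounded_linear (\<lambda>Q. trace ((P::real^'n^'n) ** Q))"
  by (rule bounded_linear_compose[OF bounded_linear_trace matmul.bounded_linear_right])

definition log_trace_exp_grad :: "('m::finite \<Rightarrow> real^'n^'n) \<Rightarrow> real^'m \<Rightarrow> real^'m \<Rightarrow> real^'m" where
  "log_trace_exp_grad A b y = (\<chi> i. trace (matrix_exp (lin_comb A y) ** A i)
     / trace (matrix_exp (lin_comb A y)) - b $ i)"

definition log_trace_exp_hess :: "('m::finite \<Rightarrow> real^'n^'n) \<Rightarrow> real^'m \<Rightarrow> real^'m^'m" where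
  "log_trace_exp_hess A y = (let M = lin_comb A y; E = matrix_exp M; Z = trace E in
     (\<chi> i j. trace (matrix_exp_deriv M (A j) ** A i) / Z
       - trace (E ** A i) * trace (E ** A j) / Z\<^sup>2))"

lemma log_trace_exp_hess_mult_vec:
  fixes A :: "'m::finite \<Rightarrow> real^'n^'n" and y :: "real^'m"
  defines "M \<equiv> lin_comb A y"
  shows "(log_trace_exp_hess A y *v h) $ i
    = trace (matrix_exp_deriv M (lin_comb A h) ** A i) / trace (matrix_exp M)
      - trace (matrix_exp M ** A i) * trace (matrix_exp M ** lin_comb A h) / (trace (matrix_exp M))\<^sup>2"
proof -
  have "bounded_linear (\<lambda>B. trace (matrix_exp_deriv M B ** A i))"
    by (rule bounded_linear_compose[OF bounded_linear_trace_mult bounded_linear_matrix_exp_deriv])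
  from bounded_linear_apply_lin_comb[OF this, of A h]
    bounded_linear_apply_lin_comb[OF bounded_linear_trace_mult_right, of "matrix_exp M" A h]
  show ?thesis
    by (simp add: log_trace_exp_hess_def Let_def matrix_vector_mult_def M_def[symmetric]
        sum_divide_distrib sum_distrib_left left_diff_distrib right_diff_distrib sum_subtractf mult_ac)
qed

lemma inner_log_trace_exp_hess:
  fixes A :: "'m::finite \<Rightarrow> real^'n^'n" and y :: "real^'m"
  defines "M \<equiv> lin_comb A y"
  shows "x \<bullet> (log_trace_exp_hess A y *v x)
    = trace (matrix_exp_deriv M (lin_comb A x) ** lin_comb A x) / trace (matrix_exp M)
      - (trace (matrix_exp M ** lin_comb A x) / trace (matrix_exp M))\<^sup>2"
proof -
  let ?B = "lin_comb A x"
  have "trace (matrix_exp_deriv M ?B ** ?B) = (\<Sum>i\<in>UNIV. x $ i * trace (matrix_exp_deriv M ?B ** A i))"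
    "trace (matrix_exp M ** ?B) = (\<Sum>i\<in>UNIV. x $ i * trace (matrix_exp M ** A i))"
    using bounded_linear_apply_lin_comb[OF bounded_linear_trace_mult_right, of _ A x] by simp_all
  moreover have "x \<bullet> (log_trace_exp_hess A y *v x)
      = (\<Sum>i\<in>UNIV. x $ i * trace (matrix_exp_deriv M ?B ** A i)) / trace (matrix_exp M)
        - (\<Sum>i\<in>UNIV. x $ i * trace (matrix_exp M ** A i)) * trace (matrix_exp M ** ?B) / (trace (matrix_exp M))\<^sup>2"
    by (simp add: inner_vec_def log_trace_exp_hess_mult_vec M_def[symmetric] right_diff_distrib
        sum_subtractf sum_divide_distrib sum_distrib_left mult_ac)
  ultimately show ?thesis by (simp add: power2_eq_square)
qed

lemma symmetric_log_trace_exp_hess: "symmetric_matrix (log_trace_exp_hess A y)"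
proof -
  have "log_trace_exp_hess A y $ i $ j = log_trace_exp_hess A y $ j $ i" for i j
    using trace_matrix_exp_deriv_commute[of "lin_comb A y" "A i" "A j"]
    by (simp add: log_trace_exp_hess_def Let_def mult.commute)
  then show ?thesis by (simp add: symmetric_matrix_def transpose_def vec_eq_iff)
qed

text \<open>
  Positivity of the partition function, which the logarithm and the quotients below need.
\<close>

lemma trace_matrix_exp_pos:
  fixes M :: "real^'n^'n"
  assumes "symmetric_matrix M" shows "0 < trace (matrix_exp M)"
proof -
  obtain \<mu> where \<mu>: "\<mu> > 0" "\<And>x. \<mu> * (x \<bullet> x) \<le> x \<bullet> (matrix_exp M *v x)"
    using symmetric_matrix_exp_min_eigenvalue[OF assms] by metis
  have "\<mu> \<le> axis i 1 \<bullet> (matrix_exp M *v axis i 1)" for i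
    using \<mu>(2)[of "axis i 1"] by (simp add: inner_axis_axis)
  then show ?thesis
    unfolding trace_eq_sum_axis using \<mu>(1) by (intro sum_pos) (auto intro: less_le_trans)
qed

lemma has_derivative_matrix_exp_lin_comb:
  "((\<lambda>y. matrix_exp (lin_comb A y)) has_derivative (\<lambda>h. matrix_exp_deriv (lin_comb A y) (lin_comb A h))) (at y)"
  by (rule has_derivative_compose[OF bounded_linear_imp_has_derivative[OF bounded_linear_lin_comb]
        has_derivative_matrix_exp])

lemma has_derivative_trace_exp_lin_comb:
  "((\<lambda>y. trace (matrix_exp (lin_comb A y))) has_derivative
    (\<lambda>h. trace (matrix_exp (lin_comb A y) ** lin_comb A h))) (at y)"
  using bounded_linear.has_derivative[OF bounded_linear_trace has_derivative_matrix_exp_lin_comb]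
  by (simp add: trace_matrix_exp_deriv)

lemma gderiv_log_trace_exp:
  assumes A: "\<And>i. symmetric_matrix (A i)"
  shows "GDERIV (log_trace_exp A b) y :> log_trace_exp_grad A b y"
proof -
  let ?E = "matrix_exp (lin_comb A y)"
  have pos: "trace ?E > 0" by (intro trace_matrix_exp_pos symmetric_lin_comb A)
  have "(log_trace_exp A b has_derivative
      (\<lambda>h. trace (?E ** lin_comb A h) * inverse (trace ?E) - b \<bullet> h)) (at y)"
    unfolding log_trace_exp_def[abs_def]
    by (intro has_derivative_diff has_derivative_ln[OF pos has_derivative_trace_exp_lin_comb]
        bounded_linear_imp_has_derivative bounded_linear_inner_right)
  moreover have "trace (?E ** lin_comb A h) * inverse (trace ?E) - b \<bullet> h
      = h \<bullet> log_trace_exp_grad A b y" for h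
    using bounded_linear_apply_lin_comb[OF bounded_linear_trace_mult_right, of ?E A h]
    by (simp add: inner_vec_def log_trace_exp_grad_def right_diff_distrib sum_subtractf
        sum_distrib_left divide_inverse mult_ac)
  ultimately show ?thesis by (simp add: gderiv_def)
qed

lemma has_hessian_log_trace_exp:
  assumes A: "\<And>i. symmetric_matrix (A i)"
  shows "has_hessian (log_trace_exp A b) (log_trace_exp_hess A y) y"
proof -
  let ?M = "lin_comb A y"
  let ?Z = "trace (matrix_exp ?M)"
  have pos: "?Z > 0" by (intro trace_matrix_exp_pos symmetric_lin_comb A)
  have "((\<lambda>y. log_trace_exp_grad A b y $ i) has_derivative (\<lambda>h. (log_trace_exp_hess A y *v h) $ i)) (at y)" for i
  proof -
    have "((\<lambda>y. trace (matrix_exp (lin_comb A y) ** A i)) has_derivative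
        (\<lambda>h. trace (matrix_exp_deriv ?M (lin_comb A h) ** A i))) (at y)"
      by (rule bounded_linear.has_derivative[OF bounded_linear_trace_mult has_derivative_matrix_exp_lin_comb])
    from has_derivative_diff[OF has_derivative_divide'[OF this has_derivative_trace_exp_lin_comb[of A y]] has_derivative_const[of "b $ i"]]
    have "((\<lambda>y. log_trace_exp_grad A b y $ i) has_derivative
        (\<lambda>h. (trace (matrix_exp_deriv ?M (lin_comb A h) ** A i) * ?Z
          - trace (matrix_exp ?M ** A i) * trace (matrix_exp ?M ** lin_comb A h)) / (?Z * ?Z))) (at y)"
      using pos by (simp add: log_trace_exp_grad_def)
    moreover have "(trace (matrix_exp_deriv ?M (lin_comb A h) ** A i) * ?Z
          - trace (matrix_exp ?M ** A i) * trace (matrix_exp ?M ** lin_comb A h)) / (?Z * ?Z)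
        = (log_trace_exp_hess A y *v h) $ i" for h
      using pos by (simp add: log_trace_exp_hess_mult_vec diff_divide_distrib power2_eq_square)
    ultimately show ?thesis by simp
  qed
  then have "(log_trace_exp_grad A b has_derivative (\<lambda>h. log_trace_exp_hess A y *v h)) (at y)"
    by (subst has_derivative_componentwise_within) (auto simp: Basis_vec_def inner_axis)
  then show ?thesis
    unfolding has_hessian_def
    by (intro exI[of _ "log_trace_exp_grad A b"] conjI always_eventually allI gderiv_log_trace_exp A)
qed

section \<open>Centring and the Gram matrix\<close>

lemma trace_centered_mult:
  fixes P Q :: "real^'n^'n"
  shows "trace (centered P ** centered Q) = trace (P ** Q) - trace P * trace Q / CARD('n)"
  by (simp add: centered_def matmul.diff_left matmul.diff_right matmul.scaleR_left matmul.scaleR_right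
      trace_linear trace_I)

lemma bounded_linear_centered: "bounded_linear (centered :: real^'n^'n \<Rightarrow> real^'n^'n)"
  by (intro linear_conv_bounded_linear[THEN iffD1] linearI)
     (auto simp: centered_def trace_linear add_divide_distrib algebra_simps)

lemma inner_centered_gram:
  "x \<bullet> (centered_gram A *v x) = trace (centered (lin_comb A x) ** centered (lin_comb A x))"
proof -
  let ?B = "lin_comb A x"
  have "bounded_linear (\<lambda>P. trace (centered P ** centered ?B))"
    by (rule bounded_linear_compose[OF bounded_linear_trace_mult bounded_linear_centered])
  from bounded_linear_apply_lin_comb[OF this, of A x]
  have "trace (centered ?B ** centered ?B) = (\<Sum>i\<in>UNIV. x $ i * trace (centered (A i) ** centered ?B))"
    by simp
  moreover have "trace (centered (A i) ** centered ?B)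
      = (\<Sum>j\<in>UNIV. x $ j * trace (centered (A i) ** centered (A j)))" for i
  proof -
    have "bounded_linear (\<lambda>Q. trace (centered (A i) ** centered Q))"
      by (rule bounded_linear_compose[OF bounded_linear_trace_mult_right bounded_linear_centered])
    from bounded_linear_apply_lin_comb[OF this, of A x] show ?thesis by simp
  qed
  ultimately show ?thesis
    by (simp add: inner_vec_def matrix_vector_mult_def centered_gram_def mult_ac)
qed

lemma symmetric_centered_gram: "symmetric_matrix (centered_gram A)"
  by (auto simp: symmetric_matrix_def transpose_def centered_gram_def vec_eq_iff intro: trace_mul_sym)

lemma trace_square_nonneg:
  assumes "symmetric_matrix H" shows "0 \<le> trace (H ** H)"
  using trace_mult_pos_semidef_nonneg[OF pos_semidef_mat_1 pos_semidef_congruence[OF pos_semidef_mat_1 assms]]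
  by simp

text \<open>
  The right-hand side is a quadratic in $c$ with minimum at $c = \mathrm{tr}\,B / n$, where it equals
  the left-hand side.
\<close>

lemma trace_centered_square_le:
  fixes B :: "real^'n^'n"
  shows "trace (centered B ** centered B) \<le> trace ((B - c *\<^sub>R mat 1) ** (B - c *\<^sub>R mat 1))"
proof -
  let ?n = "real CARD('n)"
  have "trace ((B - c *\<^sub>R mat 1) ** (B - c *\<^sub>R mat 1)) = trace (B ** B) - 2 * c * trace B + c^2 * ?n"
    by (simp add: matmul.diff_left matmul.diff_right matmul.scaleR_left matmul.scaleR_right
        trace_linear trace_I power2_eq_square right_diff_distrib)
  moreover have "(trace B - c * ?n)^2 / ?n = (trace B)^2 / ?n - 2 * c * trace B + c^2 * ?n"
    by (simp add: power2_eq_square field_simps)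
  moreover have "0 \<le> (trace B - c * ?n)^2 / ?n" by simp
  ultimately show ?thesis
    by (simp add: trace_centered_mult power2_eq_square)
qed

text \<open>
  For $c = \mathrm{tr}(\exp(M) B)/\mathrm{tr}\exp M$ the last two terms add up to
  $-c^2\,\mathrm{tr}\exp M$, which after normalisation is the squared mean that the Hessian form
  subtracts.
\<close>

lemma trace_matrix_exp_deriv_shift:
  fixes B :: "real^'n^'n"
  shows "trace (matrix_exp_deriv M (B - c *\<^sub>R mat 1) ** (B - c *\<^sub>R mat 1))
    = trace (matrix_exp_deriv M B ** B) - 2 * c * trace (matrix_exp M ** B) + c^2 * trace (matrix_exp M)"
  by (simp add: linear_simps[OF bounded_linear_matrix_exp_deriv] matrix_exp_deriv_mat_1
      matmul.diff_left matmul.diff_right matmul.scaleR_left matmul.scaleR_right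
      trace_linear trace_matrix_exp_deriv power2_eq_square right_diff_distrib)

section \<open>The Hessian bound\<close>

theorem lemma7:
  fixes A :: "'m::finite \<Rightarrow> real^'n^'n" and b y :: "real^'m"
  assumes "\<And>i. symmetric_matrix (A i)"
    and "inj A" and "mat 1 \<notin> range A" and "independent (insert (mat 1) (range A))"
  shows "pos_def (gibbs_matrix A y)
    \<and> has_hessian (log_trace_exp A b) (hessian (log_trace_exp A b) y) y
    \<and> lambda_min (gibbs_matrix A y) *\<^sub>R centered_gram A \<preceq>\<^sub>L hessian (log_trace_exp A b) y"
proof (intro conjI)
  define M E Z X where "M = lin_comb A y" and "E = matrix_exp M" and "Z = trace E"
    and "X = gibbs_matrix A y"
  have X: "X = (1 / Z) *\<^sub>R E"
    by (simp add: X_def gibbs_matrix_def M_def E_def Z_def)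
  have symM: "symmetric_matrix M" unfolding M_def by (intro symmetric_lin_comb assms(1))
  have symX: "symmetric_matrix X"
    using symmetric_matrix_exp[OF symM] by (simp add: X E_def symmetric_matrix_def transpose_linear)
  have Z: "Z > 0" unfolding Z_def E_def by (rule trace_matrix_exp_pos[OF symM])
  obtain \<mu> where \<mu>: "\<mu> > 0" "\<mu> \<in> eigenvalues E" "\<And>x. \<mu> * (x \<bullet> x) \<le> x \<bullet> (E *v x)"
    "\<And>H. symmetric_matrix H \<Longrightarrow> \<mu> * trace (H ** H) \<le> trace (matrix_exp_deriv M H ** H)"
    using symmetric_matrix_exp_min_eigenvalue[OF symM] unfolding E_def by metis
  have "0 < x \<bullet> (X *v x)" if "x \<noteq> 0" for x
  proof -
    have "0 < \<mu> * (x \<bullet> x)" using \<mu>(1) that by simp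
    also have "\<dots> \<le> x \<bullet> (E *v x)" by (rule \<mu>(3))
    finally show ?thesis using Z by (simp add: X matvec.scaleR_left)
  qed
  then show "pos_def (gibbs_matrix A y)"
    using symX unfolding pos_def_def X_def[symmetric] by blast
  have hess: "has_hessian (log_trace_exp A b) (log_trace_exp_hess A y) y"
    by (rule has_hessian_log_trace_exp[OF assms(1)])
  then show "has_hessian (log_trace_exp A b) (hessian (log_trace_exp A b) y) y"
    by (simp add: hessian_eq)
  have "\<mu> / Z \<in> eigenvalues X"
    using \<mu>(2) by (auto simp: eigenvalues_def X matvec.scaleR_left)
  then have le: "lambda_min X \<le> \<mu> / Z"
    unfolding lambda_min_def by (intro Min_le finite_eigenvalues_symmetric symX)
  have "lambda_min X * (x \<bullet> (centered_gram A *v x)) \<le> x \<bullet> (log_trace_exp_hess A y *v x)" for x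
  proof -
    define B where "B = lin_comb A x"
    \<comment> \<open>The mean of $B$ in the Gibbs state, so that $H$ has mean zero.\<close>
    define c where "c = trace (E ** B) / Z"
    define H where "H = B - c *\<^sub>R mat 1"
    have symB: "symmetric_matrix B" unfolding B_def by (intro symmetric_lin_comb assms(1))
    have symH: "symmetric_matrix H"
      using symB by (simp add: H_def symmetric_matrix_def transpose_linear transpose_mat)
    have sym0: "symmetric_matrix (centered B)"
      using symB by (simp add: centered_def symmetric_matrix_def transpose_linear transpose_mat)
    have "lambda_min X * (x \<bullet> (centered_gram A *v x)) = lambda_min X * trace (centered B ** centered B)"
      by (simp add: inner_centered_gram B_def)
    also have "\<dots> \<le> \<mu> / Z * trace (centered B ** centered B)"
      by (intro mult_right_mono le trace_square_nonneg sym0)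
    also have "\<dots> \<le> \<mu> / Z * trace (H ** H)"
      unfolding H_def using \<mu>(1) Z by (intro mult_left_mono trace_centered_square_le) simp
    also have "\<dots> \<le> trace (matrix_exp_deriv M H ** H) / Z"
      using \<mu>(4)[OF symH] Z by (simp add: divide_right_mono)
    also have "trace (matrix_exp_deriv M H ** H)
        = trace (matrix_exp_deriv M B ** B) - 2 * c * trace (E ** B) + c^2 * Z"
      unfolding H_def E_def Z_def by (rule trace_matrix_exp_deriv_shift)
    also have "\<dots> / Z = trace (matrix_exp_deriv M B ** B) / Z - (trace (E ** B) / Z)\<^sup>2"
      using Z by (simp add: c_def power2_eq_square field_simps)
    also have "\<dots> = x \<bullet> (log_trace_exp_hess A y *v x)"
      by (simp add: inner_log_trace_exp_hess B_def M_def E_def Z_def)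
    finally show ?thesis .
  qed
  moreover have "symmetric_matrix (log_trace_exp_hess A y - lambda_min X *\<^sub>R centered_gram A)"
    using symmetric_log_trace_exp_hess[of A y] symmetric_centered_gram[of A]
    by (simp add: symmetric_matrix_def transpose_linear)
  ultimately show "lambda_min (gibbs_matrix A y) *\<^sub>R centered_gram A \<preceq>\<^sub>L hessian (log_trace_exp A b) y"
    by (simp add: hessian_eq[OF hess] loewner_le_def pos_semidef_def matvec.diff_left matvec.scaleR_left
        inner_diff_right X_def)
qed

end
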